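(* Let $m\le n$, let $h\in\mathcal{F}_{\mu,L}(\mathbb{R}^m)$, let $A\in\mathbb{R}^{m\times n}$ have full row-rank, and let $f:\mathbb{R}^n\to\mathbb{R}$ be given by $f(x)=h(Ax)$. Let $x_*$ belong to the set of minimizers of $f$ on $\mathbb{R}^n$ and let $f_*=f(x_* )$. Denote $\kappa_h=\frac{\mu}{L}$ and $\kappa(A)=\frac{\lambda_{\min}(AA^T)}{\lambda_{\max}(AA^T)}$, where $\lambda_{\min}(AA^T)$ and $\lambda_{\max}(AA^T)$ are the smallest and largest eigenvalues of $AA^T$, respectively. Then, for every starting point $x_0\in\mathbb{R}^n$, every sequence $(x_i)_{i\ge 0}$ generated by the gradient method with exact line search applied to $f$ satisfies $$f(x_{i+1})-f_*\leq \left(\frac{2-\kappa(A)-\kappa(A)\kappa_h}{2-\kappa(A)+\kappa(A)\kappa_h}\right)^2 \bigl(f(x_{i})-f_*\bigr),\qquad i=0,1,2,\dots$$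
   Context: $\|\cdot\|$ is the Euclidean norm. For constants $0<\mu\le L$, $\mathcal{F}_{\mu,L}(\mathbb{R}^m)$ denotes the class of strongly convex, continuously differentiable functions $h:\mathbb{R}^m\to\mathbb{R}$ with Lipschitz continuous gradient, described by: $\|\nabla h(x)-\nabla h(y)\|\le L\|x-y\|$ and $\langle\nabla h(x)-\nabla h(y),x-y\rangle\ge\mu\|x-y\|^2$ for all $x,y\in\mathbb{R}^m$. The gradient method with exact line search (Cauchy algorithm) applied to a function $f:\mathbb{R}^n\to\mathbb{R}$ from a starting point $x_0\in\mathbb{R}^n$ generates iterates as follows: for $i=0,1,2,\dots$, choose $\gamma_i\in\arg\min_{\gamma\in\mathbb{R}} f(x_i-\gamma\nabla f(x_i))$ and set $x_{i+1}=x_i-\gamma_i\nabla f(x_i)$. *)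

theory Defs
  imports "HOL-Analysis.Analysis"
begin

text \<open>\<open>GDERIV\<close> is the library's relational form of the gradient. The value of
  \<open>gradient f x\<close> is meaningful only where \<open>f\<close> is differentiable.\<close>

definition gradient :: "('a::real_inner \<Rightarrow> real) \<Rightarrow> 'a \<Rightarrow> 'a" where
  "gradient f x = (THE D. GDERIV f x :> D)"

lemma gradient_eqI:
  assumes "GDERIV f x :> D"
  shows "gradient f x = D"
  unfolding gradient_def
proof (rule the_equality)
  show "GDERIV f x :> D" by fact
next
  fix E assume "GDERIV f x :> E"
  with assms have "(\<lambda>h. h \<bullet> E) = (\<lambda>h. h \<bullet> D)"
    unfolding gderiv_def by (rule has_derivative_unique[rotated])
  then have "(E - D) \<bullet> E = (E - D) \<bullet> D" by (rule fun_cong)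
  then have "(E - D) \<bullet> (E - D) = 0" by (simp only: inner_diff_right diff_self)
  then show "E = D" by (simp only: inner_eq_zero_iff right_minus_eq)
qed

text \<open>The class of continuously differentiable functions on $R^m$ whose gradient is
  \<open>L\<close>-Lipschitz and \<open>\<mu>\<close>-strongly monotone.\<close>

definition strongly_convex_smooth :: "real \<Rightarrow> real \<Rightarrow> (real ^ 'm \<Rightarrow> real) set" where
  "strongly_convex_smooth \<mu> L = {h.
     (\<forall>x. h differentiable (at x)) \<and>
     continuous_on UNIV (gradient h) \<and>
     (\<forall>x y. norm (gradient h x - gradient h y) \<le> L * norm (x - y)) \<and>
     (\<forall>x y. (gradient h x - gradient h y) \<bullet> (x - y) \<ge> \<mu> * (norm (x - y))\<^sup>2)}"

definition eigenvalues :: "real ^ 'm ^ 'm \<Rightarrow> real set" where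
  "eigenvalues M = {c. \<exists>v. v \<noteq> 0 \<and> M *v v = c *\<^sub>R v}"

text \<open>Only real eigenvalues are considered; below these are applied to symmetric matrices,
  whose set of eigenvalues is finite, nonempty and real.\<close>

definition lambda_min :: "real ^ 'm ^ 'm \<Rightarrow> real" where
  "lambda_min M = Min (eigenvalues M)"

definition lambda_max :: "real ^ 'm ^ 'm \<Rightarrow> real" where
  "lambda_max M = Max (eigenvalues M)"

text \<open>The minimizing step size need not be unique (for instance where the gradient vanishes), so
  the method is a predicate on sequences rather than a function of the starting point.
  The step size ranges over all reals.\<close>

definition exact_line_search_sequence ::
    "('a::real_inner \<Rightarrow> real) \<Rightarrow> 'a \<Rightarrow> (nat \<Rightarrow> 'a) \<Rightarrow> bool" where
  "exact_line_search_sequence f x0 x \<longleftrightarrow>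
     x 0 = x0 \<and>
     (\<forall>i. \<exists>\<gamma>. is_arg_min (\<lambda>t::real. f (x i - t *\<^sub>R gradient f (x i))) (\<lambda>_. True) \<gamma> \<and>
               x (Suc i) = x i - \<gamma> *\<^sub>R gradient f (x i))"

end

theory Submission
  imports Defs
begin

text \<open>
  All gradients of \<open>f x = h (A x)\<close> lie in the row space \<open>V\<close> of \<open>A\<close>, so the iterates never leave the
  coset of \<open>V\<close> through the starting point, and this coset contains a minimizer because \<open>A\<close> has full
  row rank (\<open>exists_same_image_in_row_space_coset\<close>). On \<open>V\<close> the norm of \<open>A v\<close> is comparable to that of
  \<open>v\<close>, with the extremal eigenvalues of \<open>A ** transpose A\<close> as constants
  (\<open>norm_mult_ge_lambda_min_row_space\<close>, \<open>norm_mult_le_lambda_max\<close>). Hence \<open>f\<close> satisfies along \<open>V\<close>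
  the quadratic bounds of an \<open>a\<close>-strongly convex and \<open>b\<close>-smooth function, where \<open>a\<close> is \<open>\<mu>\<close> times the
  smallest and \<open>b\<close> is \<open>L\<close> times the largest eigenvalue.

  For such a function one step of exact line search contracts the objective gap by
  \<open>((b - a) / (b + a))\<^sup>2\<close>, the sharp rate of de Klerk, Glineur and Taylor
  (\<open>exact_line_search_contraction\<close>). Three instances of the interpolation inequality
  \<open>smooth_strongly_convex_interpolation\<close> are added with suitable weights; what remains after using
  that consecutive gradients are orthogonal is a sum of two squares
  (\<open>line_search_certificate\<close>).

  Since \<open>a / b = \<kappa>A * \<kappa>h\<close>, that rate is the square of \<open>(1 - \<kappa>A * \<kappa>h) / (1 + \<kappa>A * \<kappa>h)\<close>.
  The factor claimed is obtained by replacing \<open>\<kappa>A * \<kappa>h\<close> with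
  \<open>\<kappa>A * \<kappa>h / (2 - \<kappa>A)\<close>, which is no larger as \<open>\<kappa>A \<le> 1\<close>, and is therefore at least as large (\<open>contraction_factor_mono\<close>).
\<close>

section \<open>Gradients and directional derivatives\<close>

lemma GDERIV_gradient:
  fixes f :: "'a::euclidean_space \<Rightarrow> real"
  assumes "f differentiable (at x)"
  shows "GDERIV f x :> gradient f x"
proof -
  obtain f' where f': "(f has_derivative f') (at x)"
    using assms by (auto simp: differentiable_def)
  interpret bounded_linear f' using f' by (rule has_derivative_bounded_linear)
  have "f' = (\<lambda>h. h \<bullet> (\<Sum>i\<in>Basis. f' i *\<^sub>R i))"
  proof
    fix h
    have "f' h = f' (\<Sum>i\<in>Basis. (h \<bullet> i) *\<^sub>R i)" by (simp add: euclidean_representation)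
    also have "\<dots> = h \<bullet> (\<Sum>i\<in>Basis. f' i *\<^sub>R i)"
      by (simp add: sum scaleR inner_sum_right mult.commute)
    finally show "f' h = h \<bullet> (\<Sum>i\<in>Basis. f' i *\<^sub>R i)" .
  qed
  then have "GDERIV f x :> (\<Sum>i\<in>Basis. f' i *\<^sub>R i)" using f' by (simp add: gderiv_def)
  then show ?thesis using gradient_eqI by metis
qed

lemma GDERIV_compose_matrix:
  fixes A :: "real ^ 'n ^ 'm"
  assumes "GDERIV h (A *v x) :> D"
  shows "GDERIV (\<lambda>y. h (A *v y)) x :> D v* A"
proof -
  have "((*v) A has_derivative (*v) A) (at x)"
    by (rule bounded_linear_imp_has_derivative[OF matrix_vector_mul_bounded_linear])
  moreover have "(h has_derivative (\<lambda>d. d \<bullet> D)) (at (A *v x))"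
    using assms by (simp add: gderiv_def)
  ultimately have "((\<lambda>y. h (A *v y)) has_derivative (\<lambda>d. (A *v d) \<bullet> D)) (at x)"
    by (rule has_derivative_compose)
  moreover have "(A *v d) \<bullet> D = d \<bullet> (D v* A)" for d
    using dot_lmul_matrix[of D A d] by (simp only: inner_commute)
  ultimately show ?thesis by (simp only: gderiv_def)
qed

lemma DERIV_along_line:
  fixes f :: "'a::real_inner \<Rightarrow> real"
  assumes "GDERIV f (x + t *\<^sub>R d) :> D"
  shows "((\<lambda>s. f (x + s *\<^sub>R d)) has_real_derivative D \<bullet> d) (at t)"
proof -
  have "((\<lambda>s. x + s *\<^sub>R d) has_derivative (\<lambda>s. s *\<^sub>R d)) (at t)"
    by (auto intro!: derivative_eq_intros)
  moreover have "(f has_derivative (\<lambda>v. v \<bullet> D)) (at (x + t *\<^sub>R d))"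
    using assms by (simp add: gderiv_def)
  ultimately have "((\<lambda>s. f (x + s *\<^sub>R d)) has_derivative (\<lambda>s. (s *\<^sub>R d) \<bullet> D)) (at t)"
    by (rule has_derivative_compose)
  then show ?thesis
    by (simp add: has_field_derivative_def inner_commute mult.commute[of _ "D \<bullet> d"] mult_commute_abs)
qed

text \<open>With \<open>d\<close> a negative gradient this is the orthogonality of consecutive gradients, the only
  consequence of exactness of the line search that the rate depends on. With \<open>t = 0\<close> and \<open>d = D\<close>
  it shows that the gradient vanishes at a minimizer.\<close>

lemma line_minimizer_orthogonal:
  fixes f :: "'a::real_inner \<Rightarrow> real"
  assumes "GDERIV f (x + t *\<^sub>R d) :> D" and "\<And>s. f (x + t *\<^sub>R d) \<le> f (x + s *\<^sub>R d)"
  shows "D \<bullet> d = 0"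
  by (rule DERIV_local_min[OF DERIV_along_line[OF assms(1)] zero_less_one]) (use assms(2) in blast)

section \<open>Quadratic bounds and interpolation\<close>

text \<open>Subtracting from \<open>f\<close> its linearisation at \<open>x\<close> and the quadratic term leaves a function that
  monotonicity of the gradient makes nondecreasing along the ray from \<open>x\<close> to \<open>y\<close>. The constant \<open>a\<close>
  may be negative, so that the upper bound follows by applying this to \<open>- f\<close>.\<close>

lemma quadratic_lower_bound:
  fixes f :: "'a::real_inner \<Rightarrow> real"
  assumes deriv: "\<And>x. GDERIV f x :> g x"
    and mono: "\<And>x y. (g x - g y) \<bullet> (x - y) \<ge> a * (norm (x - y))\<^sup>2"
  shows "f y \<ge> f x + g x \<bullet> (y - x) + a / 2 * (norm (y - x))\<^sup>2"
proof -
  define d where "d = y - x"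
  define \<phi> where "\<phi> t = f (x + t *\<^sub>R d) - t * (g x \<bullet> d) - a / 2 * t\<^sup>2 * (norm d)\<^sup>2" for t
  have \<phi>': "(\<phi> has_real_derivative (g (x + t *\<^sub>R d) - g x) \<bullet> d - a * t * (norm d)\<^sup>2) (at t)" for t
  proof -
    have line: "((\<lambda>s. f (x + s *\<^sub>R d)) has_real_derivative g (x + t *\<^sub>R d) \<bullet> d) (at t)"
      by (rule DERIV_along_line[OF deriv])
    have "((\<lambda>s. s * (g x \<bullet> d)) has_real_derivative g x \<bullet> d) (at t)"
      and "((\<lambda>s. a / 2 * s\<^sup>2 * (norm d)\<^sup>2) has_real_derivative a * t * (norm d)\<^sup>2) (at t)"
      by (auto intro!: derivative_eq_intros)
    from DERIV_diff[OF DERIV_diff[OF line this(1)] this(2)]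
    show ?thesis unfolding \<phi>_def by (simp add: inner_diff_left)
  qed
  have "(g (x + t *\<^sub>R d) - g x) \<bullet> d - a * t * (norm d)\<^sup>2 \<ge> 0" if "0 \<le> t" for t
  proof (cases "t = 0")
    case False
    with that have "t > 0" by simp
    have "t * (a * t * (norm d)\<^sup>2) \<le> t * ((g (x + t *\<^sub>R d) - g x) \<bullet> d)"
      using mono[of "x + t *\<^sub>R d" x] by (simp add: power_mult_distrib power2_eq_square mult_ac)
    then show ?thesis using \<open>t > 0\<close> by simp
  qed simp
  then have "\<exists>D. (\<phi> has_real_derivative D) (at t) \<and> D \<ge> 0" if "0 \<le> t" for t
    using \<phi>'[of t] that by blast
  then have "\<phi> 0 \<le> \<phi> 1"
    by (rule DERIV_nonneg_imp_nondecreasing[OF zero_le_one])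
  then show ?thesis by (simp add: \<phi>_def d_def)
qed

lemma quadratic_upper_bound:
  fixes f :: "'a::real_inner \<Rightarrow> real"
  assumes deriv: "\<And>x. GDERIV f x :> g x"
    and mono: "\<And>x y. (g x - g y) \<bullet> (x - y) \<le> b * (norm (x - y))\<^sup>2"
  shows "f y \<le> f x + g x \<bullet> (y - x) + b / 2 * (norm (y - x))\<^sup>2"
proof -
  have "(- g u - - g v) \<bullet> (u - v) \<ge> (- b) * (norm (u - v))\<^sup>2" for u v
    using mono[of u v] by (simp add: inner_diff_left)
  from quadratic_lower_bound[OF GDERIV_minus[OF deriv] this, of x y]
  show ?thesis by simp
qed

text \<open>This refines the lower quadratic bound: smoothness prevents \<open>f\<close> from coming close to that bound at
  a point where its gradient is far from the gradient of the bound. The two quadratic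
  bounds are assumed only between points that differ by an element of \<open>V\<close>, because \<open>h (A x)\<close> is
  strongly convex only along the row space of \<open>A\<close>; the test point of the proof stays in the same
  coset of \<open>V\<close>, as all gradients lie in \<open>V\<close>.\<close>

lemma smooth_strongly_convex_interpolation:
  fixes f :: "'a::real_inner \<Rightarrow> real"
  assumes V: "subspace V" and g: "\<And>x. g x \<in> V"
    and lower: "\<And>x y. y - x \<in> V \<Longrightarrow> f y \<ge> f x + g x \<bullet> (y - x) + a / 2 * (norm (y - x))\<^sup>2"
    and upper: "\<And>x y. y - x \<in> V \<Longrightarrow> f y \<le> f x + g x \<bullet> (y - x) + b / 2 * (norm (y - x))\<^sup>2"
    and "a < b" and "u - v \<in> V"
  shows "2 * (b - a) * (f u - f v - g v \<bullet> (u - v))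
       \<ge> (norm (g u - g v))\<^sup>2 - 2 * a * ((g u - g v) \<bullet> (u - v)) + a * b * (norm (u - v))\<^sup>2"
proof -
  \<comment> \<open>The point \<open>y\<close> is the gradient step from \<open>u\<close> for \<open>f - f v - g v \<bullet> (\<cdot> - v) - a/2 |\<cdot> - v|\<^sup>2\<close>,
    a function that is nonnegative by the lower bound and \<open>(b - a)\<close>-smooth by the upper one; such
    a step gains at least \<open>|G|\<^sup>2 / (2 * (b - a))\<close>, where \<open>G\<close> is the gradient at \<open>u\<close>.\<close>
  define c where "c = b - a"
  define d where "d = u - v"
  define G where "G = g u - g v - a *\<^sub>R d"
  define y where "y = u - (1 / c) *\<^sub>R G"
  have "c > 0" using \<open>a < b\<close> by (simp add: c_def)
  have "G \<in> V" unfolding G_def d_def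
    by (intro subspace_diff[OF V subspace_diff[OF V g g]] subspace_scale[OF V] \<open>u - v \<in> V\<close>)
  then have yu: "y - u \<in> V" unfolding y_def using V by (simp add: subspace_neg subspace_scale)
  have yv: "y - v \<in> V" using subspace_add[OF V yu \<open>u - v \<in> V\<close>] by simp
  have e: "y - u = - (1 / c) *\<^sub>R G" "y - v = d - (1 / c) *\<^sub>R G"
    by (simp_all add: y_def d_def)
  have "f v + g v \<bullet> (d - (1 / c) *\<^sub>R G) + a / 2 * (norm (d - (1 / c) *\<^sub>R G))\<^sup>2
      \<le> f u + g u \<bullet> (- (1 / c) *\<^sub>R G) + b / 2 * (norm (- (1 / c) *\<^sub>R G))\<^sup>2"
    using lower[OF yv] upper[OF yu] unfolding e by linarith
  then have "f u - f v - g v \<bullet> d \<ge> (G \<bullet> (g u - g v)) / c + a / 2 * (d \<bullet> d) - a * (G \<bullet> d) / c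
      + a / 2 * (G \<bullet> G) / c\<^sup>2 - b / 2 * (G \<bullet> G) / c\<^sup>2"
    unfolding power2_norm_eq_inner
    by (simp add: inner_simps inner_commute power2_eq_square diff_divide_distrib algebra_simps)
  also have "(G \<bullet> (g u - g v)) / c + a / 2 * (d \<bullet> d) - a * (G \<bullet> d) / c
      + a / 2 * (G \<bullet> G) / c\<^sup>2 - b / 2 * (G \<bullet> G) / c\<^sup>2
      = (G \<bullet> (g u - g v - a *\<^sub>R d)) / c + a / 2 * (d \<bullet> d) - c / 2 * (G \<bullet> G) / c\<^sup>2"
  proof -
    have "b = a + c" by (simp add: c_def)
    then show ?thesis using \<open>c > 0\<close> by (simp add: inner_diff_right inner_add_right field_simps)
  qed
  also have "\<dots> = a / 2 * (d \<bullet> d) + (G \<bullet> G) / (2 * c)"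
    using \<open>c > 0\<close> by (simp add: G_def[symmetric] power2_eq_square)
  finally have "2 * c * (f u - f v - g v \<bullet> d) \<ge> 2 * c * (a / 2 * (d \<bullet> d) + (G \<bullet> G) / (2 * c))"
    using \<open>c > 0\<close> by (intro mult_left_mono) auto
  also have "2 * c * (a / 2 * (d \<bullet> d) + (G \<bullet> G) / (2 * c)) = c * a * (d \<bullet> d) + G \<bullet> G"
    using \<open>c > 0\<close> by (simp add: field_simps)
  also have "\<dots> = (norm (g u - g v))\<^sup>2 - 2 * a * ((g u - g v) \<bullet> d) + a * b * (norm d)\<^sup>2"
    unfolding power2_norm_eq_inner c_def G_def
    by (simp add: inner_diff_left inner_diff_right inner_commute algebra_simps)
  finally show ?thesis by (simp add: c_def d_def)
qed

section \<open>One step of exact line search\<close>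

text \<open>Here \<open>e0\<close> and \<open>e1\<close> stand for the displacements of two consecutive iterates from the minimizer,
  and \<open>g0\<close> and \<open>g1\<close> for the gradients there. The interpolation inequalities for the pairs (iterate,
  next iterate), (minimizer, iterate) and (minimizer, next iterate) give lower bounds for
  \<open>2 * (b - a)\<close> times a difference of function values; the left-hand side is \<open>b\<close> times a weighted sum
  of these lower bounds. The weights
  \<open>(b - a) * s\<close>, \<open>2 * a * (b - a)\<close> and \<open>2 * a * s\<close> are an optimal dual solution of the semidefinite
  program for the worst case of the method. At that solution the quadratic form in
  \<open>(e0, e1, g0, g1)\<close> has rank two; completing squares in \<open>e0\<close> and \<open>e1\<close> gives the right-hand side.\<close>

lemma line_search_certificate:
  fixes e0 e1 g0 g1 :: "'a::real_inner" and a b :: real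
  assumes "g0 \<bullet> g1 = 0" and "g1 \<bullet> (e0 - e1) = 0"
  defines "s \<equiv> a + b"
  shows "b * ((b - a) * s *
            ((norm (g0 - g1))\<^sup>2 - 2 * a * ((g0 - g1) \<bullet> (e0 - e1)) + a * b * (norm (e0 - e1))\<^sup>2)
          + 2 * a * (b - a) * ((norm g0)\<^sup>2 - 2 * b * (g0 \<bullet> e0) + a * b * (norm e0)\<^sup>2)
          + 2 * a * s * ((norm g1)\<^sup>2 - 2 * b * (g1 \<bullet> e1) + a * b * (norm e1)\<^sup>2))
       = a * (norm ((b * s) *\<^sub>R e1 - (b * (b - a)) *\<^sub>R e0 + (b - a) *\<^sub>R g0 - s *\<^sub>R g1))\<^sup>2
         + (b - a) * (norm ((2 * a * b) *\<^sub>R e0 - s *\<^sub>R (g0 + g1)))\<^sup>2"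
proof -
  have *: "g0 \<bullet> g1 = 0" "g1 \<bullet> g0 = 0" "e0 \<bullet> g1 = e1 \<bullet> g1" "g1 \<bullet> e0 = e1 \<bullet> g1"
    "g0 \<bullet> e0 = e0 \<bullet> g0" "g0 \<bullet> e1 = e1 \<bullet> g0" "g1 \<bullet> e1 = e1 \<bullet> g1" "e1 \<bullet> e0 = e0 \<bullet> e1"
    using assms by (auto simp: inner_diff_right inner_commute)
  show ?thesis
    unfolding s_def power2_norm_eq_inner
    by (simp only: inner_simps inner_scaleR_left inner_scaleR_right *) algebra
qed

lemma exact_line_search_contraction_strict:
  fixes f :: "'a::real_inner \<Rightarrow> real"
  assumes V: "subspace V" and g: "\<And>x. g x \<in> V"
    and lower: "\<And>x y. y - x \<in> V \<Longrightarrow> f y \<ge> f x + g x \<bullet> (y - x) + a / 2 * (norm (y - x))\<^sup>2"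
    and upper: "\<And>x y. y - x \<in> V \<Longrightarrow> f y \<le> f x + g x \<bullet> (y - x) + b / 2 * (norm (y - x))\<^sup>2"
    and "0 < a" and "a < b"
    and z: "g z = 0" "z - x0 \<in> V"
    and x1: "x1 = x0 - t *\<^sub>R g x0" and orth: "g x0 \<bullet> g x1 = 0"
  shows "f x1 - f z \<le> ((b - a) / (b + a))\<^sup>2 * (f x0 - f z)"
proof -
  have interp: "2 * (b - a) * (f u - f v - g v \<bullet> (u - v))
       \<ge> (norm (g u - g v))\<^sup>2 - 2 * a * ((g u - g v) \<bullet> (u - v)) + a * b * (norm (u - v))\<^sup>2"
    if "u - v \<in> V" for u v
    by (rule smooth_strongly_convex_interpolation[OF V g lower upper \<open>a < b\<close> that])
  define e0 where "e0 = x0 - z"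
  define e1 where "e1 = x1 - z"
  define g0 where "g0 = g x0"
  define g1 where "g1 = g x1"
  define s where "s = a + b"
  have "s > 0" using \<open>0 < a\<close> \<open>a < b\<close> by (simp add: s_def)
  have step: "e0 - e1 = t *\<^sub>R g0" by (simp add: e0_def e1_def x1 g0_def)
  have o: "g0 \<bullet> g1 = 0" using orth by (simp add: g0_def g1_def)
  then have o': "g1 \<bullet> (e0 - e1) = 0" by (simp add: step inner_commute)
  have V01: "x0 - x1 \<in> V" using V g by (simp add: x1 subspace_scale)
  have "z - x1 = (z - x0) + (x0 - x1)" by simp
  then have Vz1: "z - x1 \<in> V" using V V01 z(2) subspace_add by metis
  have ds: "x0 - x1 = e0 - e1" "z - x0 = - e0" "z - x1 = - e1" by (auto simp: e0_def e1_def)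
  define I01 where "I01 = (norm (g0 - g1))\<^sup>2 - 2 * a * ((g0 - g1) \<bullet> (e0 - e1)) + a * b * (norm (e0 - e1))\<^sup>2"
  define Iz0 where "Iz0 = (norm g0)\<^sup>2 - 2 * b * (g0 \<bullet> e0) + a * b * (norm e0)\<^sup>2"
  define Iz1 where "Iz1 = (norm g1)\<^sup>2 - 2 * b * (g1 \<bullet> e1) + a * b * (norm e1)\<^sup>2"
  have i1: "2 * (b - a) * (f x0 - f x1) \<ge> I01"
    using interp[OF V01] o' unfolding ds g0_def[symmetric] g1_def[symmetric] I01_def by simp
  have i2: "2 * (b - a) * (f z - f x0) \<ge> Iz0"
    using interp[OF z(2)] unfolding ds g0_def[symmetric] z(1) Iz0_def by (simp add: algebra_simps)
  have i3: "2 * (b - a) * (f z - f x1) \<ge> Iz1"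
    using interp[OF Vz1] unfolding ds g1_def[symmetric] z(1) Iz1_def by (simp add: algebra_simps)
  \<comment> \<open>With these weights the differences of function values add up to a multiple
    of \<open>(b - a)\<^sup>2 * (f x0 - f z) - s\<^sup>2 * (f x1 - f z)\<close>, whose nonnegativity is the claim, and their lower
    bounds add up to a sum of two squares.\<close>
  have "0 \<le> b * ((b - a) * s * I01 + 2 * a * (b - a) * Iz0 + 2 * a * s * Iz1)"
    unfolding I01_def Iz0_def Iz1_def s_def line_search_certificate[OF o o']
    using \<open>0 < a\<close> \<open>a < b\<close> by simp
  then have "0 \<le> (b - a) * s * I01 + 2 * a * (b - a) * Iz0 + 2 * a * s * Iz1"
    using \<open>0 < a\<close> \<open>a < b\<close> by (simp add: zero_le_mult_iff)
  also have "\<dots> \<le> (b - a) * s * (2 * (b - a) * (f x0 - f x1))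
      + 2 * a * (b - a) * (2 * (b - a) * (f z - f x0)) + 2 * a * s * (2 * (b - a) * (f z - f x1))"
    using \<open>0 < a\<close> \<open>a < b\<close> \<open>s > 0\<close> by (intro add_mono mult_left_mono i1 i2 i3) auto
  also have "\<dots> = 2 * (b - a) * ((b - a)\<^sup>2 * (f x0 - f z) - s\<^sup>2 * (f x1 - f z))"
    unfolding s_def by algebra
  finally have "s\<^sup>2 * (f x1 - f z) \<le> (b - a)\<^sup>2 * (f x0 - f z)"
    using \<open>a < b\<close> by (simp add: zero_le_mult_iff)
  then show ?thesis using \<open>s > 0\<close>
    by (simp add: s_def power_divide field_simps)
qed

text \<open>A function that is \<open>b\<close>-smooth is \<open>b'\<close>-smooth for every \<open>b' > b\<close>, so the degenerate case \<open>a = b\<close>, in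
  which the interpolation inequality no longer bounds the function values, is reached by letting
  \<open>b'\<close> decrease to \<open>b\<close>.\<close>

lemma exact_line_search_contraction:
  fixes f :: "'a::real_inner \<Rightarrow> real"
  assumes V: "subspace V" and g: "\<And>x. g x \<in> V"
    and lower: "\<And>x y. y - x \<in> V \<Longrightarrow> f y \<ge> f x + g x \<bullet> (y - x) + a / 2 * (norm (y - x))\<^sup>2"
    and upper: "\<And>x y. y - x \<in> V \<Longrightarrow> f y \<le> f x + g x \<bullet> (y - x) + b / 2 * (norm (y - x))\<^sup>2"
    and "0 < a" and "a \<le> b"
    and z: "g z = 0" "z - x0 \<in> V"
    and x1: "x1 = x0 - t *\<^sub>R g x0" and orth: "g x0 \<bullet> g x1 = 0"
  shows "f x1 - f z \<le> ((b - a) / (b + a))\<^sup>2 * (f x0 - f z)"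
proof -
  have *: "f x1 - f z \<le> ((b' - a) / (b' + a))\<^sup>2 * (f x0 - f z)" if "b < b'" for b'
  proof (rule exact_line_search_contraction_strict[OF V g lower _ \<open>0 < a\<close> _ z x1 orth])
    show "f y \<le> f x + g x \<bullet> (y - x) + b' / 2 * (norm (y - x))\<^sup>2" if "y - x \<in> V" for x y
      using upper[OF that] mult_right_mono[of "b / 2" "b' / 2" "(norm (y - x))\<^sup>2"] \<open>b < b'\<close> by simp
  qed (use that \<open>a \<le> b\<close> in auto)
  have "((\<lambda>b'. ((b' - a) / (b' + a))\<^sup>2 * (f x0 - f z)) \<longlongrightarrow> ((b - a) / (b + a))\<^sup>2 * (f x0 - f z)) (at_right b)"
    using \<open>0 < a\<close> \<open>a \<le> b\<close> by (auto intro!: tendsto_intros)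
  moreover have "\<forall>\<^sub>F b' in at_right b. f x1 - f z \<le> ((b' - a) / (b' + a))\<^sup>2 * (f x0 - f z)"
    using * by (auto simp: eventually_at_filter)
  ultimately show ?thesis
    by (rule tendsto_lowerbound) simp
qed

lemma contraction_factor_mono:
  fixes a b s :: real
  assumes "0 < a" "a \<le> b" "1 \<le> s"
  shows "((b - a) / (b + a))\<^sup>2 \<le> ((s * b - a) / (s * b + a))\<^sup>2"
proof (rule power_mono)
  have eq: "(c - a) / (c + a) = 1 - 2 * a / (c + a)" if "0 < c" for c
    using that \<open>0 < a\<close> by (simp add: field_simps)
  have "0 < b" and "b \<le> s * b" using assms by simp_all
  then have "2 * a / (s * b + a) \<le> 2 * a / (b + a)"
    using \<open>0 < a\<close> by (intro divide_left_mono mult_pos_pos) linarith+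
  then show "(b - a) / (b + a) \<le> (s * b - a) / (s * b + a)"
    using eq[of b] eq[of "s * b"] \<open>0 < b\<close> \<open>b \<le> s * b\<close> by simp
  show "0 \<le> (b - a) / (b + a)" using assms by simp
qed

section \<open>Extremal eigenvalues of a symmetric matrix\<close>

text \<open>Eigenvectors for different eigenvalues are orthogonal, hence linearly independent. Finiteness
  is what gives the \<open>Min\<close> and \<open>Max\<close> in \<open>lambda_min\<close> and \<open>lambda_max\<close> their meaning.\<close>

lemma finite_eigenvalues_symmetric:
  fixes M :: "real ^ 'm ^ 'm"
  assumes sym: "transpose M = M"
  shows "finite (eigenvalues M)"
proof -
  have sa: "(M *v x) \<bullet> y = x \<bullet> (M *v y)" for x y
    by (metis sym dot_lmul_matrix transpose_matrix_vector)
  define e where "e c = (SOME v. v \<noteq> 0 \<and> M *v v = c *\<^sub>R v)" for c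
  have e: "e c \<noteq> 0" "M *v e c = c *\<^sub>R e c" if "c \<in> eigenvalues M" for c
    using someI_ex[of "\<lambda>v. v \<noteq> 0 \<and> M *v v = c *\<^sub>R v"] that by (auto simp: e_def eigenvalues_def)
  have orth: "e c \<bullet> e d = 0" if "c \<in> eigenvalues M" "d \<in> eigenvalues M" "c \<noteq> d" for c d
    using sa[of "e c" "e d"] e that by simp
  have inj: "inj_on e (eigenvalues M)"
    using orth e by (metis inj_onI inner_eq_zero_iff)
  have "independent (e ` eigenvalues M)"
    using orth e by (intro pairwise_orthogonal_independent)
      (auto simp: pairwise_def orthogonal_def)
  then have "finite (e ` eigenvalues M)" by (rule independent_imp_finite)
  then show ?thesis using inj by (rule finite_imageD)
qed

text \<open>The quadratic form of \<open>M\<close> attains a minimum on the unit sphere, and the point where it does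
  is an eigenvector.\<close>

lemma rayleigh_minimum_eigenvalue:
  fixes M :: "real ^ 'm ^ 'm"
  assumes sym: "transpose M = M"
  obtains c where "c \<in> eigenvalues M" "\<And>w. c * (norm w)\<^sup>2 \<le> w \<bullet> (M *v w)"
proof -
  have sa: "(M *v x) \<bullet> y = x \<bullet> (M *v y)" for x y
    by (metis sym dot_lmul_matrix transpose_matrix_vector)
  have "continuous_on (sphere 0 1) (\<lambda>w. w \<bullet> (M *v w))"
    by (intro continuous_intros linear_continuous_on matrix_vector_mul_bounded_linear)
  moreover have "sphere (0 :: real ^ 'm) 1 \<noteq> {}" by simp
  ultimately obtain v where v: "norm v = 1"
      and vmin: "\<And>w. norm w = 1 \<Longrightarrow> v \<bullet> (M *v v) \<le> w \<bullet> (M *v w)"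
    using continuous_attains_inf[of "sphere (0 :: real ^ 'm) 1" "\<lambda>w. w \<bullet> (M *v w)"] by auto
  define c where "c = v \<bullet> (M *v v)"
  have quad: "c * (norm w)\<^sup>2 \<le> w \<bullet> (M *v w)" for w
  proof (cases "w = 0")
    case False
    define u where "u = (1 / norm w) *\<^sub>R w"
    have w: "w = norm w *\<^sub>R u" and "norm u = 1" using False by (simp_all add: u_def)
    have "w \<bullet> (M *v w) = (norm w)\<^sup>2 * (u \<bullet> (M *v u))"
      by (subst (1 2) w) (simp add: matrix_vector_mult_scaleR power2_eq_square)
    then show ?thesis
      using mult_left_mono[OF vmin[OF \<open>norm u = 1\<close>], of "(norm w)\<^sup>2"]
      by (simp add: c_def mult.commute)
  qed simp
  \<comment> \<open>First-order optimality of \<open>v\<close>: the nonnegative form \<open>w \<bullet> M w - c |w|\<^sup>2\<close> vanishes at \<open>v\<close>,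
    so a nonzero residual \<open>r\<close> would make it negative at \<open>v + t r\<close> for a small \<open>t < 0\<close>.\<close>
  define r where "r = M *v v - c *\<^sub>R v"
  define Q where "Q = r \<bullet> (M *v r) - c * (norm r)\<^sup>2"
  have ineq: "0 \<le> 2 * t * (r \<bullet> r) + t\<^sup>2 * Q" for t
  proof -
    have "c * ((v + t *\<^sub>R r) \<bullet> (v + t *\<^sub>R r)) \<le> (v + t *\<^sub>R r) \<bullet> (M *v (v + t *\<^sub>R r))"
      using quad[of "v + t *\<^sub>R r"] by (simp add: power2_norm_eq_inner)
    moreover have "(v + t *\<^sub>R r) \<bullet> (M *v (v + t *\<^sub>R r))
        = c + 2 * t * (r \<bullet> (M *v v)) + t\<^sup>2 * (r \<bullet> (M *v r))"
    proof -
      have "v \<bullet> (M *v r) = r \<bullet> (M *v v)" using sa[of v r] by (simp add: inner_commute)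
      then show ?thesis
        by (simp add: matrix_vector_right_distrib matrix_vector_mult_scaleR inner_add_left
              inner_add_right c_def power2_eq_square algebra_simps)
    qed
    moreover have "(v + t *\<^sub>R r) \<bullet> (v + t *\<^sub>R r) = 1 + 2 * t * (r \<bullet> v) + t\<^sup>2 * (r \<bullet> r)"
      using v by (simp add: inner_add_left inner_add_right inner_commute[of v r] norm_eq_1
          power2_eq_square algebra_simps)
    ultimately have "c * (1 + 2 * t * (r \<bullet> v) + t\<^sup>2 * (r \<bullet> r))
        \<le> c + 2 * t * (r \<bullet> (M *v v)) + t\<^sup>2 * (r \<bullet> (M *v r))" by simp
    moreover have "r \<bullet> (M *v v) = r \<bullet> r + c * (r \<bullet> v)"
      using inner_diff_right[of r "M *v v" "c *\<^sub>R v"] by (simp add: r_def[symmetric])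
    ultimately show ?thesis
      by (simp add: Q_def power2_norm_eq_inner algebra_simps)
  qed
  have "Q \<ge> 0" using quad[of r] by (simp add: Q_def)
  have "r \<bullet> r = 0"
  proof (rule ccontr)
    assume "r \<bullet> r \<noteq> 0"
    then have R: "r \<bullet> r > 0" using inner_ge_zero[of r] by linarith
    \<comment> \<open>The denominator is \<open>Q + 1\<close> rather than \<open>Q\<close> because \<open>Q\<close> may be zero.\<close>
    define t where "t = - (r \<bullet> r) / (Q + 1)"
    have "t < 0" using R \<open>Q \<ge> 0\<close> by (simp add: t_def divide_neg_pos)
    have "t * (Q + 1) = - (r \<bullet> r)" using \<open>Q \<ge> 0\<close> by (simp add: t_def)
    then have "t * Q = - (r \<bullet> r) - t" by (simp add: algebra_simps)
    have "2 * t * (r \<bullet> r) + t\<^sup>2 * Q = t * (2 * (r \<bullet> r) + t * Q)"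
      by (simp add: power2_eq_square algebra_simps)
    also have "\<dots> = t * (r \<bullet> r - t)" by (simp add: \<open>t * Q = - (r \<bullet> r) - t\<close>)
    also have "\<dots> < 0" using \<open>t < 0\<close> R by (intro mult_neg_pos) linarith+
    finally show False using ineq[of t] by simp
  qed
  then have "M *v v = c *\<^sub>R v" by (simp add: r_def)
  moreover have "v \<noteq> 0" using v by auto
  ultimately have "c \<in> eigenvalues M" by (auto simp: eigenvalues_def)
  then show thesis using quad that by blast
qed

lemma lambda_min_symmetric:
  fixes M :: "real ^ 'm ^ 'm"
  assumes "transpose M = M"
  shows "lambda_min M \<in> eigenvalues M" "lambda_min M * (norm w)\<^sup>2 \<le> w \<bullet> (M *v w)"
proof -
  obtain c where c: "c \<in> eigenvalues M" "\<And>w. c * (norm w)\<^sup>2 \<le> w \<bullet> (M *v w)"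
    using rayleigh_minimum_eigenvalue[OF assms] by blast
  note fin = finite_eigenvalues_symmetric[OF assms]
  show "lambda_min M \<in> eigenvalues M"
    unfolding lambda_min_def using fin c(1) by (intro Min_in) auto
  have "lambda_min M \<le> c" unfolding lambda_min_def using fin c(1) by (rule Min_le)
  then show "lambda_min M * (norm w)\<^sup>2 \<le> w \<bullet> (M *v w)"
    using c(2)[of w] mult_right_mono[of "lambda_min M" c "(norm w)\<^sup>2"] by simp
qed

lemma lambda_max_symmetric:
  fixes M :: "real ^ 'm ^ 'm"
  assumes sym: "transpose M = M"
  shows "w \<bullet> (M *v w) \<le> lambda_max M * (norm w)\<^sup>2"
proof -
  \<comment> \<open>Maximising the Rayleigh quotient of \<open>M\<close> is minimising that of \<open>- M\<close>.\<close>
  have neg: "(- M) *v v = - (M *v v)" for v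
    by (simp add: matrix_vector_mult_def vec_eq_iff sum_negf)
  have "transpose (- M) = - M"
    using sym by (simp add: transpose_def vec_eq_iff)
  then obtain c where c: "c \<in> eigenvalues (- M)" "\<And>w. c * (norm w)\<^sup>2 \<le> w \<bullet> ((- M) *v w)"
    using rayleigh_minimum_eigenvalue by blast
  have "- c \<in> eigenvalues M"
    using c(1) unfolding eigenvalues_def neg
    by (auto simp: neg_eq_iff_add_eq_0 eq_neg_iff_add_eq_0)
  then have "- c \<le> lambda_max M"
    unfolding lambda_max_def using finite_eigenvalues_symmetric[OF sym] by (intro Max_ge)
  then show ?thesis
    using c(2)[of w] mult_right_mono[of "- c" "lambda_max M" "(norm w)\<^sup>2"] by (simp add: neg)
qed

lemma lambda_min_le_lambda_max:
  fixes M :: "real ^ 'm ^ 'm"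
  assumes "transpose M = M"
  shows "lambda_min M \<le> lambda_max M"
  using lambda_min_symmetric(2)[OF assms, of "axis undefined 1"] lambda_max_symmetric[OF assms, of "axis undefined 1"]
  by (simp add: norm_axis_1)

section \<open>The Gram matrix of the rows and the row space\<close>

lemma inner_gram:
  fixes A :: "real ^ 'n ^ 'm"
  shows "w \<bullet> ((A ** transpose A) *v w) = (norm (w v* A))\<^sup>2"
  by (simp add: matrix_vector_mul_assoc[symmetric] dot_lmul_matrix[symmetric] power2_norm_eq_inner)

lemma transpose_gram: "transpose (A ** transpose A) = A ** transpose (A :: real ^ 'n ^ 'm)"
  by (simp add: matrix_transpose_mul transpose_transpose)

lemma linear_vector_matrix_mult: "linear (\<lambda>w. w v* (A :: real ^ 'n ^ 'm))"
  using matrix_vector_mul_linear[of "transpose A"] by simp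

lemma vector_matrix_mult_eq_0_iff_full_rank:
  fixes A :: "real ^ 'n ^ 'm"
  assumes "rank A = CARD('m)"
  shows "w v* A = 0 \<longleftrightarrow> w = 0"
proof
  assume "w v* A = 0"
  obtain y where "w = A *v y"
    using assms unfolding full_rank_surjective by (meson surjD)
  then have "w \<bullet> w = (w v* A) \<bullet> y" by (simp add: dot_lmul_matrix)
  then show "w = 0" using \<open>w v* A = 0\<close> by simp
qed simp

lemma lambda_min_gram_pos:
  fixes A :: "real ^ 'n ^ 'm"
  assumes "rank A = CARD('m)"
  shows "lambda_min (A ** transpose A) > 0"
proof -
  let ?c = "lambda_min (A ** transpose A)"
  obtain v where v: "v \<noteq> 0" "(A ** transpose A) *v v = ?c *\<^sub>R v"
    using lambda_min_symmetric(1)[OF transpose_gram] by (auto simp: eigenvalues_def)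
  have "?c * (norm v)\<^sup>2 = (norm (v v* A))\<^sup>2"
    by (metis v(2) inner_gram inner_scaleR_right power2_norm_eq_inner)
  also have "\<dots> > 0" using v(1) vector_matrix_mult_eq_0_iff_full_rank[OF assms] by simp
  finally show ?thesis by (simp add: zero_less_mult_iff)
qed

lemma exists_same_image_in_row_space_coset:
  fixes A :: "real ^ 'n ^ 'm"
  assumes "rank A = CARD('m)"
  obtains z where "A *v z = A *v y" "z - x \<in> range (\<lambda>w. w v* A)"
proof -
  let ?M = "A ** transpose A"
  have "inj ((*v) ?M)"
  proof (rule linear_injective_0[THEN iffD2, OF matrix_vector_mul_linear], intro allI impI)
    fix w assume "?M *v w = 0"
    then have "norm (w v* A) = 0" using inner_gram[of w A] by simp
    then show "w = 0" using vector_matrix_mult_eq_0_iff_full_rank[OF assms] by simp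
  qed
  then have "surj ((*v) ?M)"
    by (simp only: full_rank_injective[symmetric] full_rank_surjective[symmetric])
  then obtain w where w: "?M *v w = A *v (y - x)" by (metis surjD)
  have "A *v (x + w v* A) = A *v y"
    using w by (simp add: matrix_vector_mul_assoc[symmetric] algebra_simps)
  then show thesis by (intro that[of "x + w v* A"]) auto
qed

text \<open>For \<open>v = w v* A\<close> the Rayleigh bound controls \<open>|w|\<close> by \<open>|v|\<close>, and \<open>|v|\<^sup>2 = w \<bullet> (A v)\<close> is at most
  \<open>|w| |A v|\<close>. Thus the smallest eigenvalue of \<open>A ** transpose A\<close> bounds the restriction of \<open>A\<close> to its
  row space from below, although \<open>A\<close> may have a kernel.\<close>

lemma norm_mult_ge_lambda_min_row_space:
  fixes A :: "real ^ 'n ^ 'm"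
  assumes "v \<in> range (\<lambda>w. w v* A)"
  shows "lambda_min (A ** transpose A) * (norm v)\<^sup>2 \<le> (norm (A *v v))\<^sup>2"
proof -
  let ?c = "lambda_min (A ** transpose A)"
  obtain w where v: "v = w v* A" using assms by auto
  have ray: "?c * (norm w)\<^sup>2 \<le> (norm v)\<^sup>2"
    using lambda_min_symmetric(2)[OF transpose_gram] by (simp only: inner_gram v)
  have "(norm v)\<^sup>2 = w \<bullet> (A *v v)"
    by (simp add: v dot_lmul_matrix[symmetric] power2_norm_eq_inner)
  also have "\<dots> \<le> norm w * norm (A *v v)" by (rule norm_cauchy_schwarz)
  finally have cs: "(norm v)\<^sup>2 \<le> norm w * norm (A *v v)" .
  show ?thesis
  proof (cases "v = 0 \<or> ?c \<le> 0")
    case True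
    moreover have "?c * (norm v)\<^sup>2 \<le> 0" if "?c \<le> 0"
      using that by (simp add: mult_nonpos_nonneg)
    moreover have "0 \<le> (norm (A *v v))\<^sup>2" by simp
    ultimately show ?thesis by (elim disjE) (simp, linarith)
  next
    case False
    then have "?c > 0" "(norm v)\<^sup>2 > 0" by auto
    have "((norm v)\<^sup>2)\<^sup>2 \<le> (norm w * norm (A *v v))\<^sup>2"
      using cs by (intro power_mono) auto
    then have "?c * ((norm v)\<^sup>2)\<^sup>2 \<le> ?c * (norm w)\<^sup>2 * (norm (A *v v))\<^sup>2"
      using \<open>?c > 0\<close> by (simp add: power_mult_distrib)
    also have "\<dots> \<le> (norm v)\<^sup>2 * (norm (A *v v))\<^sup>2"
      using ray by (intro mult_right_mono) auto
    finally have "(norm v)\<^sup>2 * (?c * (norm v)\<^sup>2) \<le> (norm v)\<^sup>2 * (norm (A *v v))\<^sup>2"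
      by (simp add: power2_eq_square mult_ac)
    then show ?thesis using \<open>(norm v)\<^sup>2 > 0\<close> by (rule mult_left_le_imp_le)
  qed
qed

text \<open>By duality: \<open>|A v|\<^sup>2 = ((A v) v* A) \<bullet> v\<close>, and the Rayleigh bound applies to the vector
  \<open>A v\<close>.\<close>

lemma norm_mult_le_lambda_max:
  fixes A :: "real ^ 'n ^ 'm"
  shows "(norm (A *v v))\<^sup>2 \<le> lambda_max (A ** transpose A) * (norm v)\<^sup>2"
proof (cases "A *v v = 0")
  case True
  \<comment> \<open>The quadratic form of a Gram matrix is nonnegative, so its value at any unit vector shows
    that \<open>lambda_max\<close> is nonnegative.\<close>
  have "0 \<le> lambda_max (A ** transpose A) * (norm (axis undefined 1 :: real ^ 'm))\<^sup>2"
    by (metis (no_types) inner_gram lambda_max_symmetric[OF transpose_gram] order_trans zero_le_power2)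
  then show ?thesis using True by (simp add: norm_axis_1)
next
  case False
  define u where "u = A *v v"
  have "(norm u)\<^sup>2 = (u v* A) \<bullet> v"
    by (simp add: dot_lmul_matrix power2_norm_eq_inner u_def)
  also have "\<dots> \<le> norm (u v* A) * norm v" by (rule norm_cauchy_schwarz)
  finally have "((norm u)\<^sup>2)\<^sup>2 \<le> (norm (u v* A) * norm v)\<^sup>2"
    by (intro power_mono) auto
  also have "\<dots> = (norm (u v* A))\<^sup>2 * (norm v)\<^sup>2" by (rule power_mult_distrib)
  also have "\<dots> \<le> (lambda_max (A ** transpose A) * (norm u)\<^sup>2) * (norm v)\<^sup>2"
    using lambda_max_symmetric[OF transpose_gram, of u A]
    by (intro mult_right_mono) (simp_all only: inner_gram zero_le_power2)
  finally have "(norm u)\<^sup>2 * (norm u)\<^sup>2 \<le> (norm u)\<^sup>2 * (lambda_max (A ** transpose A) * (norm v)\<^sup>2)"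
    by (simp add: power2_eq_square mult_ac)
  moreover have "(norm u)\<^sup>2 > 0" using False by (simp add: u_def)
  ultimately show ?thesis unfolding u_def by (rule mult_left_le_imp_le)
qed

section \<open>The linear rate\<close>

theorem theorem2:
  fixes \<mu> L \<kappa>h \<kappa>A :: real
    and h :: "real ^ 'm \<Rightarrow> real"
    and A :: "real ^ 'n ^ 'm"
    and f :: "real ^ 'n \<Rightarrow> real"
    and x_star x0 :: "real ^ 'n"
    and x :: "nat \<Rightarrow> real ^ 'n"
  assumes "0 < \<mu>" and "\<mu> \<le> L"
    and "CARD('m) \<le> CARD('n)"
    and "h \<in> strongly_convex_smooth \<mu> L"
    and "rank A = CARD('m)"
    and "f = (\<lambda>y. h (A *v y))"
    and "is_arg_min f (\<lambda>_. True) x_star"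
    and "\<kappa>h = \<mu> / L"
    and "\<kappa>A = lambda_min (A ** transpose A) / lambda_max (A ** transpose A)"
    and "exact_line_search_sequence f x0 x"
  shows "\<forall>i. f (x (Suc i)) - f x_star
           \<le> ((2 - \<kappa>A - \<kappa>A * \<kappa>h) / (2 - \<kappa>A + \<kappa>A * \<kappa>h))\<^sup>2 * (f (x i) - f x_star)"
proof
  fix i
  let ?M = "A ** transpose A"
  let ?V = "range (\<lambda>w. w v* A)"
  define a where "a = \<mu> * lambda_min ?M"
  define b where "b = L * lambda_max ?M"
  define g where "g y = gradient h (A *v y) v* A" for y
  have h: "\<And>x. h differentiable (at x)"
      "\<And>x y. norm (gradient h x - gradient h y) \<le> L * norm (x - y)"
      "\<And>x y. (gradient h x - gradient h y) \<bullet> (x - y) \<ge> \<mu> * (norm (x - y))\<^sup>2"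
    using assms(4) by (auto simp: strongly_convex_smooth_def)
  have dh: "GDERIV h y :> gradient h y" for y by (rule GDERIV_gradient[OF h(1)])
  have df: "GDERIV f y :> g y" for y
    unfolding assms(6) g_def by (rule GDERIV_compose_matrix[OF dh])
  have grad: "gradient f y = g y" for y by (rule gradient_eqI[OF df])
  have lmin: "0 < lambda_min ?M" by (rule lambda_min_gram_pos[OF assms(5)])
  have lmax: "lambda_min ?M \<le> lambda_max ?M" by (rule lambda_min_le_lambda_max[OF transpose_gram])
  have "0 < a" using \<open>0 < \<mu>\<close> lmin by (simp add: a_def)
  have "a \<le> b" unfolding a_def b_def using assms(1,2) lmin lmax by (intro mult_mono) auto
  have V: "subspace ?V" by (rule linear_subspace_image[OF linear_vector_matrix_mult subspace_UNIV])
  have gV: "g y \<in> ?V" for y by (simp add: g_def)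
  have lower: "f v \<ge> f u + g u \<bullet> (v - u) + a / 2 * (norm (v - u))\<^sup>2" if "v - u \<in> ?V" for u v
  proof -
    have "\<mu> / 2 * (lambda_min ?M * (norm (v - u))\<^sup>2) \<le> \<mu> / 2 * (norm (A *v (v - u)))\<^sup>2"
      using \<open>0 < \<mu>\<close> by (intro mult_left_mono norm_mult_ge_lambda_min_row_space that) auto
    then show ?thesis
      using quadratic_lower_bound[OF dh h(3), of "A *v u" "A *v v"]
      by (simp add: assms(6) g_def a_def dot_lmul_matrix matrix_vector_mult_diff_distrib)
  qed
  have hL: "(gradient h u - gradient h v) \<bullet> (u - v) \<le> L * (norm (u - v))\<^sup>2" for u v
  proof -
    have "(gradient h u - gradient h v) \<bullet> (u - v) \<le> norm (gradient h u - gradient h v) * norm (u - v)"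
      by (rule norm_cauchy_schwarz)
    also have "\<dots> \<le> L * norm (u - v) * norm (u - v)" by (rule mult_right_mono[OF h(2)]) simp
    finally show ?thesis by (simp add: power2_eq_square)
  qed
  have upper: "f v \<le> f u + g u \<bullet> (v - u) + b / 2 * (norm (v - u))\<^sup>2" for u v
  proof -
    have "L / 2 * (norm (A *v (v - u)))\<^sup>2 \<le> L / 2 * (lambda_max ?M * (norm (v - u))\<^sup>2)"
      using assms(1,2) by (intro mult_left_mono norm_mult_le_lambda_max) auto
    then show ?thesis
      using quadratic_upper_bound[OF dh hL, of "A *v v" "A *v u"]
      by (simp add: assms(6) g_def b_def dot_lmul_matrix matrix_vector_mult_diff_distrib)
  qed
  have fmin: "f x_star \<le> f y" for y
    using assms(7) by (auto simp: is_arg_min_def not_less)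
  \<comment> \<open>The minimizer \<open>x_star\<close> may differ from \<open>x i\<close> by a component in the kernel of \<open>A\<close>;
    a minimizer \<open>z\<close> with the same image under \<open>A\<close> is reachable from \<open>x i\<close> along the row space.\<close>
  obtain z where z: "A *v z = A *v x_star" "z - x i \<in> ?V"
    using exists_same_image_in_row_space_coset[OF assms(5)] by blast
  have fz: "f z = f x_star" by (simp add: assms(6) z(1))
  have "g z \<bullet> g z = 0"
    by (rule line_minimizer_orthogonal[where f = f and x = z and t = 0]) (use df fmin fz in auto)
  then have gz: "g z = 0" by simp
  obtain t where t: "\<And>s. f (x i - t *\<^sub>R g (x i)) \<le> f (x i - s *\<^sub>R g (x i))"
      and step: "x (Suc i) = x i - t *\<^sub>R g (x i)"
    using assms(10) unfolding exact_line_search_sequence_def is_arg_min_def grad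
    by (auto simp: not_less)
  have "g (x (Suc i)) \<bullet> - g (x i) = 0"
    by (rule line_minimizer_orthogonal[where f = f and x = "x i" and t = t])
      (use df[of "x (Suc i)"] t in \<open>auto simp: step\<close>)
  then have orth: "g (x i) \<bullet> g (x (Suc i)) = 0" by (simp add: inner_commute)
  have "f (x (Suc i)) - f z \<le> ((b - a) / (b + a))\<^sup>2 * (f (x i) - f z)"
    by (rule exact_line_search_contraction[OF V gV lower upper \<open>0 < a\<close> \<open>a \<le> b\<close> gz z(2) step orth])
  \<comment> \<open>The stated factor arises by replacing \<open>b\<close> with \<open>(2 - \<kappa>A) * b\<close>, and \<open>2 - \<kappa>A \<ge> 1\<close>.\<close>
  also have "\<dots> \<le> (((2 - \<kappa>A) * b - a) / ((2 - \<kappa>A) * b + a))\<^sup>2 * (f (x i) - f z)"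
    using lmin lmax fmin[of "x i"] fz \<open>0 < a\<close> \<open>a \<le> b\<close>
    by (intro mult_right_mono contraction_factor_mono) (auto simp: assms(9))
  also have "((2 - \<kappa>A) * b - a) / ((2 - \<kappa>A) * b + a)
      = (2 - \<kappa>A - \<kappa>A * \<kappa>h) / (2 - \<kappa>A + \<kappa>A * \<kappa>h)"
  proof -
    have "b \<noteq> 0" using \<open>0 < a\<close> \<open>a \<le> b\<close> by simp
    have "a = b * (\<kappa>A * \<kappa>h)"
      using assms(1,2) lmin lmax by (simp add: a_def b_def assms(8,9))
    then have "(2 - \<kappa>A) * b - a = b * (2 - \<kappa>A - \<kappa>A * \<kappa>h)"
      "(2 - \<kappa>A) * b + a = b * (2 - \<kappa>A + \<kappa>A * \<kappa>h)"
      by (simp_all add: algebra_simps)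
    then show ?thesis using \<open>b \<noteq> 0\<close> by simp
  qed
  finally show "f (x (Suc i)) - f x_star
      \<le> ((2 - \<kappa>A - \<kappa>A * \<kappa>h) / (2 - \<kappa>A + \<kappa>A * \<kappa>h))\<^sup>2 * (f (x i) - f x_star)"
    by (simp add: fz)
qed

end
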